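(* Let $\mathcal{Z}_N=\{Z^{(1)},\dots,Z^{(N)}\}\subset\mathcal{Z}$ be a given dataset and $\mathbb{P}_N=\sum_{i=1}^N\mu_i\boldsymbol{\chi}_{\{Z^{(i)}\}}\in\mathcal{P}(\mathcal{Z})$ the corresponding empirical distribution, where $\mu_i\ge 0$ and $\sum_{i=1}^N\mu_i=1$. Let $r\in[1,\infty)$ and let $d(\cdot,\cdot)$ be a cost function on $\mathcal{Z}\times\mathcal{Z}$. Let $\mathcal{B}$ be a set and suppose the loss function $\ell:\mathcal{Z}\times\mathcal{B}\to\mathbb{R}$ has the form $\ell(z;\beta)=\psi_\beta^r(z)$, where $\psi_\beta:\mathcal{Z}\to\mathbb{R}$ if $r=1$ and $\psi_\beta:\mathcal{Z}\to\mathbb{R}_+=[0,\infty)$ if $r>1$. Fix $\beta\in\mathcal{B}$ and, for $\delta\ge 0$, let $$\mathcal{S}=\sup_{\mathbb{P}\in\mathcal{P}(\mathcal{Z}):\ \mathcal{W}_{d,r}(\mathbb{P},\mathbb{P}_N)\le\delta}\mathrm{E}_{\mathbb{P}}[\ell(Z;\beta)].$$ Then the following statements hold for any $\delta\ge0$. (a) Let $\mathcal{L}_i=\sup_{\mathbb{P}\in\mathcal{P}(\mathcal{Z})}\{\mathrm{E}_{\mathbb{P}}[\ell(Z;\beta)] : \mathcal{W}_{d,r}(\mathbb{P},\boldsymbol{\chi}_{\{Z^{(i)}\}})\le\delta\}$ for $i=1,\dots,N$. Then $$\mathcal{S}\ \ge\ \mathcal{L}:=\sum_{i=1}^N\mu_i\mathcal{L}_i\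 \ge\ \mathrm{E}_{\mathbb{P}_N}[\ell(Z;\beta)].$$ (b) Suppose $\psi_\beta$ is $(L_\beta^{\mathcal{Z}_N},d)$-Lipschitz at $\mathcal{Z}_N$ with $L_\beta^{\mathcal{Z}_N}\in(0,\infty)$. Then $$\mathcal{S}\le\Big(\big(\mathrm{E}_{\mathbb{P}_N}[\ell(Z;\beta)]\big)^{1/r}+L_\beta^{\mathcal{Z}_N}\delta\Big)^r.$$ (c) Suppose $\psi_\beta$ is $(0,d)$-Lipschitz at $\mathcal{Z}_N$. Then $\mathcal{S}=\mathrm{E}_{\mathbb{P}_N}[\ell(Z;\beta)]$.
   Context: $\mathcal{Z}$ is a measurable space in which every singleton $\{z\}$ is measurable; $\mathcal{Z}\times\mathcal{Z}$ carries the product $\sigma$-algebra; $\mathcal{P}(\mathcal{Z})$ is the set of probability measures on $\mathcal{Z}$; $\boldsymbol{\chi}_{\{\hat z\}}$ is the Dirac measure at $\hat z$; $\mathrm{E}_{\mathbb{P}}[f(Z)]=\int_{\mathcal{Z}}f\,\mathrm{d}\mathbb{P}$. Standing assumption: $\ell(\cdot;\beta)$ is measurable for every $\beta\in\mathcal{B}$. Convention: $0\cdot\infty=0$. Cost function: a measurable function $d:\mathcal{Z}\times\mathcal{Z}\to[0,\infty]$ with $d(z,z)=0$ for all $z\in\mathcal{Z}$ (no symmetry, triangle inequality or positive definiteness required). Wasserstein discrepancy: for $\mathbb{P},\mathbb{Q}\in\mathcal{P}(\mathcal{Z})$ and $r\in[1,\infty)$, $\mathcal{W}_{d,r}(\mathbb{P},\mathbb{Q})=\big(\inf_{\pi\in\Pi(\mathbb{P},\mathbb{Q})}\int_{\mathcal{Z}\times\mathcal{Z}}d^r(z',z)\,\mathrm{d}\pi(z',z)\big)^{1/r}$,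 where $\Pi(\mathbb{P},\mathbb{Q})$ is the set of probability measures $\pi$ on $\mathcal{Z}\times\mathcal{Z}$ with first marginal $\mathbb{P}$ and second marginal $\mathbb{Q}$. Weak Lipschitz property: for $f:\mathcal{Z}\to\mathbb{R}$, $S\subset\mathcal{Z}$ and a constant $L\in[0,\infty)$, $f$ is called $(L,d)$-Lipschitz at $S$ if $|f(z')-f(z)|\le L\,d(z',z)$ for all $z\in S$ and $z'\in\mathcal{Z}$. *)

theory Defs
  imports "HOL-Probability.Probability"
begin

text \<open>
  A measurable space is represented by a measure \<open>M\<close> of which only \<open>space M\<close> and \<open>sets M\<close> matter;
  the set of probability measures on it is \<open>space (prob_algebra M)\<close> (lemma \<open>space_prob_algebra\<close>).
\<close>

subsection \<open>Powers\<close>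

text \<open>
  The exponent 1 is treated separately because \<open>powr\<close> does not return the base when the base is
  negative (\<open>(- x) powr 1 = x powr 1\<close>). For \<open>x \<ge> 0\<close> this is just \<open>x powr p\<close>.
\<close>
definition real_pow :: "real \<Rightarrow> real \<Rightarrow> real" where
  "real_pow x p = (if p = 1 then x else x powr p)"

text \<open>Only used with positive exponents, whence \<open>\<top>\<close> is mapped to \<open>\<top>\<close>.\<close>
definition ennreal_pow :: "ennreal \<Rightarrow> real \<Rightarrow> ennreal" where
  "ennreal_pow x p = (if x = \<top> then \<top> else ennreal (enn2real x powr p))"

subsection \<open>Wasserstein discrepancy\<close>

definition cost_function :: "'z measure \<Rightarrow> ('z \<Rightarrow> 'z \<Rightarrow> ennreal) \<Rightarrow> bool" where
  "cost_function M d \<longleftrightarrow>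
     (\<lambda>(z', z). d z' z) \<in> borel_measurable (M \<Otimes>\<^sub>M M) \<and> (\<forall>z\<in>space M. d z z = 0)"

definition couplings :: "'z measure \<Rightarrow> 'z measure \<Rightarrow> 'z measure \<Rightarrow> ('z \<times> 'z) measure set" where
  "couplings M P Q =
     {\<pi> \<in> space (prob_algebra (M \<Otimes>\<^sub>M M)). distr \<pi> M fst = P \<and> distr \<pi> M snd = Q}"

definition wasserstein ::
    "'z measure \<Rightarrow> ('z \<Rightarrow> 'z \<Rightarrow> ennreal) \<Rightarrow> real \<Rightarrow> 'z measure \<Rightarrow> 'z measure \<Rightarrow> ennreal" where
  "wasserstein M d r P Q =
     ennreal_pow (INF \<pi>\<in>couplings M P Q. \<integral>\<^sup>+ (z', z). ennreal_pow (d z' z) r \<partial>\<pi>) (1 / r)"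

definition lipschitz_at ::
    "'z measure \<Rightarrow> ('z \<Rightarrow> 'z \<Rightarrow> ennreal) \<Rightarrow> real \<Rightarrow> 'z set \<Rightarrow> ('z \<Rightarrow> real) \<Rightarrow> bool" where
  "lipschitz_at M d L S f \<longleftrightarrow>
     0 \<le> L \<and> (\<forall>z\<in>S. \<forall>z'\<in>space M. ennreal \<bar>f z' - f z\<bar> \<le> ennreal L * d z' z)"

subsection \<open>Expectations with values in the extended reals\<close>

text \<open>
  The integral of \<open>f\<close> exists in \<open>[-\<infinity>, \<infinity>]\<close> unless both the positive and the negative part have
  infinite integral. Note that \<open>ennreal (f z)\<close> is the positive part of \<open>f z\<close>.
\<close>
definition has_expectation :: "'z measure \<Rightarrow> ('z \<Rightarrow> real) \<Rightarrow> bool" where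
  "has_expectation P f \<longleftrightarrow>
     (\<integral>\<^sup>+ z. ennreal (f z) \<partial>P) < \<top> \<or> (\<integral>\<^sup>+ z. ennreal (- f z) \<partial>P) < \<top>"

definition ext_expectation :: "'z measure \<Rightarrow> ('z \<Rightarrow> real) \<Rightarrow> ereal" where
  "ext_expectation P f =
     enn2ereal (\<integral>\<^sup>+ z. ennreal (f z) \<partial>P) - enn2ereal (\<integral>\<^sup>+ z. ennreal (- f z) \<partial>P)"

text \<open>
  The supremum of \<open>E\<^sub>P[f]\<close> over the Wasserstein ball of radius \<open>\<delta>\<close> around \<open>Q\<close>. Measures for which
  \<open>E\<^sub>P[f]\<close> is of the undefined form \<open>\<infinity> - \<infinity>\<close> do not take part in the supremum.
\<close>
definition worst_case ::
    "'z measure \<Rightarrow> ('z \<Rightarrow> 'z \<Rightarrow> ennreal) \<Rightarrow> real \<Rightarrow> real \<Rightarrow> 'z measure \<Rightarrow> ('z \<Rightarrow> real) \<Rightarrow> ereal" where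
  "worst_case M d r \<delta> Q f =
     (SUP P \<in> {P \<in> space (prob_algebra M). wasserstein M d r P Q \<le> ennreal \<delta> \<and> has_expectation P f}.
        ext_expectation P f)"

lemma integrable_has_expectation:
  assumes "integrable P f"
  shows "has_expectation P f" "ext_expectation P f = ereal (\<integral>z. f z \<partial>P)"
proof -
  have fin: "(\<integral>\<^sup>+ z. ennreal (f z) \<partial>P) < \<top>" "(\<integral>\<^sup>+ z. ennreal (- f z) \<partial>P) < \<top>"
    using assms by (auto simp: real_integrable_def less_top)
  show "has_expectation P f"
    using fin by (simp add: has_expectation_def)
  have eq: "enn2ereal x = ereal (enn2real x)" if "x < \<top>" for x
    using that by (cases x) (auto simp: enn2ereal_ennreal)
  show "ext_expectation P f = ereal (\<integral>z. f z \<partial>P)"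
    unfolding ext_expectation_def real_lebesgue_integral_def[OF assms]
    using fin by (simp add: eq)
qed

subsection \<open>Empirical distributions\<close>

definition empirical ::
    "'z measure \<Rightarrow> nat \<Rightarrow> (nat \<Rightarrow> real) \<Rightarrow> (nat \<Rightarrow> 'z) \<Rightarrow> 'z measure" where
  "empirical M N \<mu> x =
     measure_of (space M) (sets M) (\<lambda>A. \<Sum>i=1..N. ennreal (\<mu> i) * emeasure (return M (x i)) A)"

lemma space_empirical [simp]: "space (empirical M N \<mu> x) = space M"
  by (simp add: empirical_def)

lemma sets_empirical [simp]: "sets (empirical M N \<mu> x) = sets M"
  by (simp add: empirical_def)

lemma emeasure_empirical:
  assumes "A \<in> sets M"
  shows "emeasure (empirical M N \<mu> x) A = (\<Sum>i=1..N. ennreal (\<mu> i) * emeasure (return M (x i)) A)"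
proof (rule emeasure_measure_of[OF empirical_def])
  show "countably_additive (sets (empirical M N \<mu> x))
          (\<lambda>A. \<Sum>i=1..N. ennreal (\<mu> i) * emeasure (return M (x i)) A)"
  proof (rule countably_additiveI)
    fix F :: "nat \<Rightarrow> 'a set"
    assume F: "range F \<subseteq> sets (empirical M N \<mu> x)" "disjoint_family F"
    have "(\<Sum>n. \<Sum>i=1..N. ennreal (\<mu> i) * emeasure (return M (x i)) (F n))
        = (\<Sum>i=1..N. \<Sum>n. ennreal (\<mu> i) * emeasure (return M (x i)) (F n))"
      by (rule suminf_sum) auto
    also have "\<dots> = (\<Sum>i=1..N. ennreal (\<mu> i) * emeasure (return M (x i)) (\<Union>n. F n))"
      using F by (intro sum.cong refl) (simp add: suminf_emeasure del: emeasure_return)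
    finally show "(\<Sum>n. \<Sum>i=1..N. ennreal (\<mu> i) * emeasure (return M (x i)) (F n))
        = (\<Sum>i=1..N. ennreal (\<mu> i) * emeasure (return M (x i)) (\<Union>n. F n))" .
  qed
qed (use assms in \<open>auto simp: sets.space_closed positive_def\<close>)

lemma empirical_in_prob_algebra:
  assumes "\<And>i. i \<in> {1..N} \<Longrightarrow> x i \<in> space M" "\<And>i. i \<in> {1..N} \<Longrightarrow> 0 \<le> \<mu> i" "(\<Sum>i=1..N. \<mu> i) = 1"
  shows "empirical M N \<mu> x \<in> space (prob_algebra M)"
proof -
  have "emeasure (empirical M N \<mu> x) (space M) = (\<Sum>i=1..N. ennreal (\<mu> i))"
    using assms(1) by (subst emeasure_empirical) (auto intro!: sum.cong)
  also have "\<dots> = 1"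
    using assms(2,3) by (subst sum_ennreal) auto
  finally show ?thesis
    by (auto simp: space_prob_algebra intro!: prob_spaceI)
qed

lemma nn_integral_empirical:
  assumes f: "f \<in> borel_measurable M" and x: "\<And>i. i \<in> {1..N} \<Longrightarrow> x i \<in> space M"
  shows "(\<integral>\<^sup>+ z. f z \<partial>empirical M N \<mu> x) = (\<Sum>i=1..N. ennreal (\<mu> i) * f (x i))"
  using f
proof (induction rule: borel_measurable_induct)
  case (cong f g)
  then have "(\<integral>\<^sup>+ z. f z \<partial>empirical M N \<mu> x) = (\<integral>\<^sup>+ z. g z \<partial>empirical M N \<mu> x)"
    by (intro nn_integral_cong) auto
  with cong x show ?case by simp
next
  case (set A)
  then show ?case by (simp add: emeasure_empirical)
next
  case (mult u c)
  then have "u \<in> borel_measurable (empirical M N \<mu> x)"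
    by (simp add: measurable_cong_sets[OF sets_empirical refl])
  with mult show ?case
    by (simp add: nn_integral_cmult sum_distrib_left mult.left_commute)
next
  case (add u v)
  then have "u \<in> borel_measurable (empirical M N \<mu> x)" "v \<in> borel_measurable (empirical M N \<mu> x)"
    by (simp_all add: measurable_cong_sets[OF sets_empirical refl])
  with add show ?case
    by (simp add: nn_integral_add sum.distrib distrib_left)
next
  case (seq U)
  then have U: "U i \<in> borel_measurable (empirical M N \<mu> x)" for i
    by (simp add: measurable_cong_sets[OF sets_empirical refl])
  have inc: "incseq (\<lambda>n. ennreal (\<mu> i) * U n (x i))" for i
    using seq(3) by (auto simp: incseq_def le_fun_def intro!: mult_left_mono)
  have "(\<integral>\<^sup>+ z. (SUP n. U n) z \<partial>empirical M N \<mu> x) = (SUP n. \<integral>\<^sup>+ z. U n z \<partial>empirical M N \<mu> x)"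
    using seq(3) U by (simp add: nn_integral_monotone_convergence_SUP image_comp)
  also have "\<dots> = (SUP n. \<Sum>i=1..N. ennreal (\<mu> i) * U n (x i))"
    using seq by simp
  also have "\<dots> = (\<Sum>i=1..N. SUP n. ennreal (\<mu> i) * U n (x i))"
    using inc by (intro ennreal_SUP_sum) auto
  finally show ?case
    by (simp add: SUP_mult_left_ennreal image_comp)
qed

lemma integrable_empirical:
  assumes f: "f \<in> borel_measurable M" and x: "\<And>i. i \<in> {1..N} \<Longrightarrow> x i \<in> space M"
  shows "integrable (empirical M N \<mu> x) (f :: _ \<Rightarrow> real)"
proof (rule integrableI_bounded)
  show "f \<in> borel_measurable (empirical M N \<mu> x)"
    using f by (simp add: measurable_cong_sets[OF sets_empirical refl])
  show "(\<integral>\<^sup>+ z. ennreal (norm (f z)) \<partial>empirical M N \<mu> x) < \<infinity>"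
    using f x by (subst nn_integral_empirical) (auto simp: ennreal_mult_less_top)
qed

end

theory Submission
  imports Defs
begin

text \<open>
  Part (a): couplings can be mixed, so if every \<open>P\<^sub>i\<close> lies in the ball of radius \<open>\<delta>\<close> around the Dirac
  measure at \<open>x i\<close>, then \<open>\<Sum> \<mu>\<^sub>i P\<^sub>i\<close> lies in the ball of radius \<open>\<delta>\<close> around the empirical
  distribution; each \<open>P\<^sub>i\<close> may be chosen with expectation above \<open>-\<infinity>\<close>, which rules out \<open>\<infinity> - \<infinity>\<close> in
  the mixture. Part (b): under a coupling \<open>\<pi>\<close> with the empirical distribution, \<open>\<pi>\<close>-almost every
  \<open>(z', z)\<close> has \<open>z\<close> in the dataset and thus \<open>\<psi> z' \<le> \<psi> z + L d(z', z)\<close>; take \<open>L\<^sup>r\<close> norms and use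
  Minkowski's inequality. For \<open>r = 1\<close>, where \<open>\<psi>\<close> may be negative, the difference \<open>\<psi> z' - \<psi> z\<close> is
  integrated instead. Part (c): with \<open>L = 0\<close> the function \<open>\<psi>\<close> is constant, even where \<open>d\<close> is
  infinite, because \<open>0 \<cdot> \<infinity> = 0\<close>.
\<close>

subsection \<open>Powers\<close>

lemma ennreal_pow_ennreal [simp]: "0 \<le> x \<Longrightarrow> ennreal_pow (ennreal x) p = ennreal (x powr p)"
  by (simp add: ennreal_pow_def)

lemma ennreal_pow_top [simp]: "ennreal_pow \<top> p = \<top>"
  by (simp add: ennreal_pow_def)

lemma ennreal_pow_0 [simp]: "ennreal_pow 0 p = 0"
  by (simp add: ennreal_pow_def)

lemma ennreal_pow_1: "ennreal_pow x 1 = x"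
  by (cases x) auto

lemma ennreal_pow_mono:
  assumes "x \<le> y" "0 \<le> p"
  shows "ennreal_pow x p \<le> ennreal_pow y p"
  using assms by (cases x; cases y) (auto intro!: ennreal_leI powr_mono2 simp: top_unique)

lemma ennreal_pow_mult:
  assumes "0 < c"
  shows "ennreal_pow (ennreal c * x) p = ennreal (c powr p) * ennreal_pow x p"
  using assms
  by (cases x) (auto simp: ennreal_mult_top powr_mult simp flip: ennreal_mult)

lemma measurable_ennreal_pow [measurable]:
  assumes [measurable]: "f \<in> borel_measurable M"
  shows "(\<lambda>z. ennreal_pow (f z) p) \<in> borel_measurable M"
  unfolding ennreal_pow_def by measurable

text \<open>Removes the outer root from the Wasserstein discrepancy, so that membership in a ball
  becomes a bound on the infimal transport cost.\<close>

lemma ennreal_pow_inverse_le_iff: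
  assumes "0 < r" "0 \<le> \<delta>"
  shows "ennreal_pow x (1 / r) \<le> ennreal \<delta> \<longleftrightarrow> x \<le> ennreal (\<delta> powr r)"
proof (cases x)
  case (real y)
  have "y powr (1 / r) \<le> \<delta> \<longleftrightarrow> (y powr (1 / r)) powr r \<le> \<delta> powr r"
    using assms by (metis powr_ge_zero powr_less_mono2 powr_mono2 less_imp_le not_less)
  also have "(y powr (1 / r)) powr r = y"
    using assms real by (simp add: powr_powr)
  finally show ?thesis
    using real assms by (simp add: ennreal_le_iff)
qed (auto simp: top_unique)

section \<open>Convexity of powers and Minkowski's inequality\<close>

text \<open>Convexity of \<open>powr\<close> is invoked only at positive \<open>x\<close> and
  \<open>y\<close>. If one of them vanishes, the claim reduces to \<open>u powr r \<le> u\<close>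
  for \<open>u\<close> in the unit interval.\<close>

lemma powr_convex_combination_le:
  fixes x y t r :: real
  assumes "1 \<le> r" "0 \<le> x" "0 \<le> y" "0 \<le> t" "t \<le> 1"
  shows "((1 - t) * x + t * y) powr r \<le> (1 - t) * x powr r + t * y powr r"
proof -
  have le: "u powr r \<le> u" if "0 \<le> u" "u \<le> 1" for u :: real
    using powr_mono'[of 1 r u] that assms(1) by simp
  consider "x = 0" | "y = 0" | "0 < x" "0 < y"
    using assms by fastforce
  then show ?thesis
  proof cases
    case 1
    then show ?thesis
      using assms le[of t] by (simp add: powr_mult mult_right_mono)
  next
    case 2
    then show ?thesis
      using assms le[of "1 - t"] by (simp add: powr_mult mult_right_mono)
  next
    case 3
    then show ?thesis
      using convex_onD[OF powr_convex[OF assms(1)], of t x y] assms by simp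
  qed
qed

text \<open>Writes \<open>(a + b) / (A + B)\<close> as the convex combination of
  \<open>a / A\<close> and \<open>b / B\<close> with weights \<open>A / (A + B)\<close> and
  \<open>B / (A + B)\<close>. Equality holds at \<open>a = A\<close>, \<open>b = B\<close>, so
  integrating this pointwise bound loses nothing in Minkowski's inequality.\<close>

lemma powr_add_le_weighted:
  fixes a b A B r :: real
  assumes "1 \<le> r" "0 \<le> a" "0 \<le> b" "0 < A" "0 < B"
  shows "(a + b) powr r \<le>
    (A + B) powr r * (A / (A + B) / A powr r * a powr r + B / (A + B) / B powr r * b powr r)"
proof -
  have weight: "1 - B / (A + B) = A / (A + B)"
    using assms by (simp add: field_simps)
  then have "(1 - B / (A + B)) * (a / A) + B / (A + B) * (b / B) = (a + b) / (A + B)"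
    using assms by (simp add: add_divide_distrib)
  moreover have "((1 - B / (A + B)) * (a / A) + B / (A + B) * (b / B)) powr r
      \<le> (1 - B / (A + B)) * (a / A) powr r + B / (A + B) * (b / B) powr r"
    using assms by (intro powr_convex_combination_le) auto
  ultimately have "((a + b) / (A + B)) powr r
      \<le> A / (A + B) / A powr r * a powr r + B / (A + B) / B powr r * b powr r"
    using assms weight by (simp add: powr_divide)
  then show ?thesis
    using assms by (simp add: powr_divide divide_simps mult.commute)
qed

text \<open>Minkowski's inequality; positive bounds in place of the norms avoid dividing by a vanishing norm.\<close>
lemma nn_integral_pow_add_le:
  fixes f g :: "'a \<Rightarrow> ennreal"
  assumes [measurable]: "f \<in> borel_measurable M" "g \<in> borel_measurable M"
    and "1 \<le> r" "0 < A" "0 < B"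
    and f: "(\<integral>\<^sup>+ z. ennreal_pow (f z) r \<partial>M) \<le> ennreal (A powr r)"
    and g: "(\<integral>\<^sup>+ z. ennreal_pow (g z) r \<partial>M) \<le> ennreal (B powr r)"
  shows "(\<integral>\<^sup>+ z. ennreal_pow (f z + g z) r \<partial>M) \<le> ennreal ((A + B) powr r)"
proof -
  \<comment> \<open>The coefficients of \<open>powr_add_le_weighted\<close>; they satisfy
    \<open>u * A powr r + v * B powr r = (A + B) powr r\<close>.\<close>
  define u v where "u = (A + B) powr r * (A / (A + B) / A powr r)"
    and "v = (A + B) powr r * (B / (A + B) / B powr r)"
  \<comment> \<open>Strict positivity makes the right-hand side below infinite as soon as
    \<open>a\<close> or \<open>b\<close> is, because \<open>0 * \<top> = 0\<close>.\<close>
  have uv: "0 < u" "0 < v"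
    using assms by (auto simp: u_def v_def)
  have "ennreal_pow (a + b) r \<le> ennreal u * ennreal_pow a r + ennreal v * ennreal_pow b r" for a b
  proof (cases a; cases b)
    fix s t assume *: "a = ennreal s" "0 \<le> s" "b = ennreal t" "0 \<le> t"
    have "(s + t) powr r \<le> u * s powr r + v * t powr r"
      using powr_add_le_weighted[of r s t A B] assms * by (simp add: u_def v_def algebra_simps)
    then show ?thesis
      using * uv by (simp flip: ennreal_plus ennreal_mult)
  qed (use uv in \<open>auto simp: ennreal_mult_top\<close>)
  then have "(\<integral>\<^sup>+ z. ennreal_pow (f z + g z) r \<partial>M)
      \<le> (\<integral>\<^sup>+ z. ennreal u * ennreal_pow (f z) r + ennreal v * ennreal_pow (g z) r \<partial>M)"
    by (intro nn_integral_mono) simp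
  also have "\<dots> = ennreal u * (\<integral>\<^sup>+ z. ennreal_pow (f z) r \<partial>M)
      + ennreal v * (\<integral>\<^sup>+ z. ennreal_pow (g z) r \<partial>M)"
    by (simp add: nn_integral_add nn_integral_cmult)
  also have "\<dots> \<le> ennreal u * ennreal (A powr r) + ennreal v * ennreal (B powr r)"
    by (intro add_mono mult_left_mono f g) auto
  also have "\<dots> = ennreal (u * A powr r + v * B powr r)"
    using uv by (simp flip: ennreal_plus ennreal_mult)
  also have "u * A powr r + v * B powr r = (A + B) powr r"
    using assms by (simp add: u_def v_def flip: distrib_left add_divide_distrib)
  finally show ?thesis .
qed

subsection \<open>Finite mixtures\<close>

locale finite_mixture =
  fixes I :: "'i set" and w :: "'i \<Rightarrow> real"
  assumes finite: "finite I" and nonneg: "\<And>i. i \<in> I \<Longrightarrow> 0 \<le> w i" and sum_1: "sum w I = 1"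
begin

text \<open>Encoded as a bind in the Giry monad, so that integrals and image measures follow from
  the rules for bind. The type \<open>'a\<close> stays free within the locale, which lets the same
  weights mix measures on \<open>M\<close> and couplings on the product.\<close>

definition mixture :: "('i \<Rightarrow> 'a measure) \<Rightarrow> 'a measure" where
  "mixture P = point_measure I (\<lambda>i. ennreal (w i)) \<bind> P"

lemma nonempty: "I \<noteq> {}"
  using sum_1 by auto

lemma point_measure_in_prob_algebra:
  "point_measure I (\<lambda>i. ennreal (w i)) \<in> space (prob_algebra (point_measure I (\<lambda>i. ennreal (w i))))"
  using finite nonneg sum_1
  by (simp add: space_prob_algebra prob_space_point_measure sum_ennreal)

lemma mixture_in_prob_algebra:
  assumes "\<And>i. i \<in> I \<Longrightarrow> P i \<in> space (prob_algebra M)"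
  shows "mixture P \<in> space (prob_algebra M)"
proof -
  have "P \<in> point_measure I (\<lambda>i. ennreal (w i)) \<rightarrow>\<^sub>M prob_algebra M"
    using assms by auto
  note * = point_measure_in_prob_algebra this
  show ?thesis
    using prob_space_bind'[OF *] sets_bind'[OF *] by (simp add: space_prob_algebra mixture_def)
qed

lemma nn_integral_mixture:
  assumes "\<And>i. i \<in> I \<Longrightarrow> P i \<in> space (prob_algebra M)" "f \<in> borel_measurable M"
  shows "(\<integral>\<^sup>+ z. f z \<partial>mixture P) = (\<Sum>i\<in>I. ennreal (w i) * (\<integral>\<^sup>+ z. f z \<partial>P i))"
  unfolding mixture_def
  using assms finite
  by (subst nn_integral_bind[where B = M])
    (auto simp: space_prob_algebra space_subprob_algebra prob_space_imp_subprob_space nn_integral_point_measure_finite)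

lemma mixture_cong:
  "(\<And>i. i \<in> I \<Longrightarrow> P i = Q i) \<Longrightarrow> mixture P = mixture Q"
  unfolding mixture_def by (intro bind_cong) (auto simp: space_point_measure)

text \<open>Applied to the two projections, this identifies the marginals of a mixture of
  couplings.\<close>

lemma distr_mixture:
  assumes "\<And>i. i \<in> I \<Longrightarrow> P i \<in> space (prob_algebra M)" "f \<in> M \<rightarrow>\<^sub>M L"
  shows "distr (mixture P) L f = mixture (\<lambda>i. distr (P i) L f)"
  unfolding mixture_def
  using assms nonempty
  by (intro distr_bind[where K = M] measurable_prob_algebraD) (auto simp: space_point_measure)

text \<open>A mixture of couplings has as cost the weighted average of the costs. The infimum over
  couplings need not be attained, so each coupling is chosen with cost below an arbitrary \<eta>
  above \<open>\<delta> powr r\<close>, and \<eta> is removed at the end by density.\<close>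

lemma wasserstein_mixture_le:
  assumes d: "(\<lambda>(z', z). d z' z) \<in> borel_measurable (M \<Otimes>\<^sub>M M)"
    and r: "0 < r" and \<delta>: "0 \<le> \<delta>"
    and le: "\<And>i. i \<in> I \<Longrightarrow> wasserstein M d r (P i) (Q i) \<le> ennreal \<delta>"
  shows "wasserstein M d r (mixture P) (mixture Q) \<le> ennreal \<delta>"
proof -
  define c where "c = (\<lambda>(z', z). ennreal_pow (d z' z) r)"
  have c: "c \<in> borel_measurable (M \<Otimes>\<^sub>M M)"
    using measurable_ennreal_pow[OF d] by (simp add: c_def case_prod_beta)
  have "(INF \<pi>\<in>couplings M (mixture P) (mixture Q). \<integral>\<^sup>+ y. c y \<partial>\<pi>) \<le> \<eta>"
    if \<eta>: "ennreal (\<delta> powr r) < \<eta>" for \<eta>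
  proof -
    have "\<exists>\<pi>\<in>couplings M (P i) (Q i). (\<integral>\<^sup>+ y. c y \<partial>\<pi>) < \<eta>" if "i \<in> I" for i
    proof -
      have "(INF \<pi>\<in>couplings M (P i) (Q i). \<integral>\<^sup>+ y. c y \<partial>\<pi>) \<le> ennreal (\<delta> powr r)"
        using le[OF that] r \<delta> by (simp add: wasserstein_def ennreal_pow_inverse_le_iff c_def)
      with \<eta> show ?thesis
        by (auto simp: INF_less_iff dest: le_less_trans)
    qed
    then obtain \<pi> where \<pi>: "\<And>i. i \<in> I \<Longrightarrow> \<pi> i \<in> couplings M (P i) (Q i)"
      "\<And>i. i \<in> I \<Longrightarrow> (\<integral>\<^sup>+ y. c y \<partial>\<pi> i) < \<eta>"
      by metis
    have prob: "\<pi> i \<in> space (prob_algebra (M \<Otimes>\<^sub>M M))" if "i \<in> I" for i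
      using \<pi>(1)[OF that] by (simp add: couplings_def)
    have "mixture \<pi> \<in> couplings M (mixture P) (mixture Q)"
      using \<pi>(1) prob
      by (auto simp: couplings_def distr_mixture[where M = "M \<Otimes>\<^sub>M M"]
          intro!: mixture_in_prob_algebra mixture_cong)
    moreover have "(\<integral>\<^sup>+ y. c y \<partial>mixture \<pi>) \<le> \<eta>"
    proof -
      have "(\<integral>\<^sup>+ y. c y \<partial>mixture \<pi>) \<le> (\<Sum>i\<in>I. ennreal (w i) * \<eta>)"
        using \<pi>(2) prob c
        by (subst nn_integral_mixture) (auto intro!: sum_mono mult_left_mono dest: less_imp_le)
      also have "\<dots> = \<eta>"
        using nonneg sum_1 by (simp add: sum_ennreal flip: sum_distrib_right)
      finally show ?thesis .
    qed
    ultimately show ?thesis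
      by (rule INF_lower2)
  qed
  then have "(INF \<pi>\<in>couplings M (mixture P) (mixture Q). \<integral>\<^sup>+ y. c y \<partial>\<pi>) \<le> ennreal (\<delta> powr r)"
    by (rule dense_ge)
  then show ?thesis
    using r \<delta> by (simp add: wasserstein_def ennreal_pow_inverse_le_iff c_def)
qed

section \<open>Weighted sums of extended-real suprema\<close>

text \<open>Reduces a sum of possibly infinite suprema to real numbers strictly below them, which
  can be beaten by actual measures. Excluding -\<infinity> keeps the sum free of the form
  \<infinity> - \<infinity>.\<close>

lemma sum_ereal_le_if_approx:
  fixes e :: "'i \<Rightarrow> ereal"
  assumes e: "\<And>i. i \<in> I \<Longrightarrow> e i \<noteq> - \<infinity>"
    and le: "\<And>c. (\<And>i. i \<in> I \<Longrightarrow> ereal (c i) < e i) \<Longrightarrow> ereal (\<Sum>i\<in>I. w i * c i) \<le> s"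
  shows "(\<Sum>i\<in>I. ereal (w i) * e i) \<le> s"
proof -
  \<comment> \<open>Real numbers strictly below \<open>e i\<close> that converge to it. With
    \<open>n\<close> in place of \<open>Suc n\<close>, strictness would fail at 0, since
    \<open>1 / 0 = 0\<close>.\<close>
  define c where "c n i = (if e i = \<infinity> then real n else real_of_ereal (e i) - 1 / real (Suc n))" for n i
  have less: "ereal (c n i) < e i" if "i \<in> I" for n i
    using e[OF that] by (cases "e i") (auto simp: c_def)
  have lim: "(\<lambda>n. ereal (c n i)) \<longlonglongrightarrow> e i" if "i \<in> I" for i
  proof (cases "e i")
    case (real a)
    have "(\<lambda>n. a - 1 / real (Suc n)) \<longlonglongrightarrow> a - 0"
      by (intro tendsto_diff tendsto_const LIMSEQ_Suc[OF lim_1_over_n])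
    with real show ?thesis
      by (simp add: c_def)
  next
    case PInf
    then show ?thesis
      using id_nat_ereal_tendsto_PInf by (simp add: c_def)
  qed (use e that in auto)
  \<comment> \<open>The second conjunct strengthens the induction: limits may be added in
    \<open>ereal\<close> once neither summand is -\<infinity>.\<close>
  have "(\<lambda>n. \<Sum>i\<in>J. ereal (w i) * ereal (c n i)) \<longlonglongrightarrow> (\<Sum>i\<in>J. ereal (w i) * e i)
      \<and> (\<Sum>i\<in>J. ereal (w i) * e i) \<noteq> - \<infinity>" if "J \<subseteq> I" for J
    using finite_subset[OF that finite] that
  proof (induction J rule: finite_induct)
    case (insert j J)
    have "ereal (w j) * e j \<noteq> - \<infinity>"
      using e[of j] nonneg[of j] insert.prems by (cases "e j") auto
    moreover have "(\<lambda>n. ereal (w j) * ereal (c n j)) \<longlonglongrightarrow> ereal (w j) * e j"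
      using lim insert.prems by (intro tendsto_cmult_ereal) auto
    ultimately show ?case
      using insert tendsto_add_ereal_general[of "ereal (w j) * e j" "\<Sum>i\<in>J. ereal (w i) * e i"
          "\<lambda>n. ereal (w j) * ereal (c n j)" sequentially]
      by (simp del: times_ereal.simps sum_ereal ereal_times)
  qed (simp del: sum_ereal)
  from this[OF order_refl]
  have "(\<lambda>n. \<Sum>i\<in>I. ereal (w i) * ereal (c n i)) \<longlonglongrightarrow> (\<Sum>i\<in>I. ereal (w i) * e i)" ..
  moreover have "(\<Sum>i\<in>I. ereal (w i) * ereal (c n i)) \<le> s" for n
    using le[OF less] by simp
  ultimately show ?thesis
    by (intro LIMSEQ_le_const2) auto
qed

text \<open>Each real \<open>c i\<close> below the i-th supremum is exceeded by the expectation
  under some \<open>P i\<close> in the i-th ball. The mixture of these \<open>P i\<close> is then a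
  competitor in the ball around \<open>mixture Q\<close>.\<close>

lemma worst_case_mixture_ge:
  assumes d: "(\<lambda>(z', z). d z' z) \<in> borel_measurable (M \<Otimes>\<^sub>M M)"
    and r: "0 < r" and \<delta>: "0 \<le> \<delta>" and f [measurable]: "f \<in> borel_measurable M"
    and ninf: "\<And>i. i \<in> I \<Longrightarrow> worst_case M d r \<delta> (Q i) f \<noteq> - \<infinity>"
  shows "(\<Sum>i\<in>I. ereal (w i) * worst_case M d r \<delta> (Q i) f) \<le> worst_case M d r \<delta> (mixture Q) f"
proof (rule sum_ereal_le_if_approx[OF ninf])
  fix c assume c: "\<And>i. i \<in> I \<Longrightarrow> ereal (c i) < worst_case M d r \<delta> (Q i) f"
  have "\<exists>P\<in>space (prob_algebra M). wasserstein M d r P (Q i) \<le> ennreal \<delta> \<and>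
      has_expectation P f \<and> ereal (c i) < ext_expectation P f" if "i \<in> I" for i
    using c[OF that] by (auto simp: worst_case_def less_SUP_iff)
  then obtain P where P: "\<And>i. i \<in> I \<Longrightarrow> P i \<in> space (prob_algebra M)"
    and W: "\<And>i. i \<in> I \<Longrightarrow> wasserstein M d r (P i) (Q i) \<le> ennreal \<delta>"
    and E: "\<And>i. i \<in> I \<Longrightarrow> has_expectation (P i) f"
      "\<And>i. i \<in> I \<Longrightarrow> ereal (c i) < ext_expectation (P i) f"
    by metis
  define p n where "p i = (\<integral>\<^sup>+ z. ennreal (f z) \<partial>P i)"
    and "n i = (\<integral>\<^sup>+ z. ennreal (- f z) \<partial>P i)" for i
  \<comment> \<open>If the negative part were infinite, the existence of the expectation would force
    the value -\<infinity>, which cannot exceed the real number \<open>c i\<close>.\<close>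
  have n: "n i < \<top>" if "i \<in> I" for i
  proof (rule ccontr)
    assume "\<not> n i < \<top>"
    then have "n i = \<top>" "p i < \<top>"
      using E(1)[OF that] by (simp_all add: has_expectation_def p_def n_def not_less top_unique)
    then have "ext_expectation (P i) f = - \<infinity>"
      by (cases "p i") (auto simp: ext_expectation_def p_def[symmetric] n_def[symmetric]
          enn2ereal_ennreal top_ennreal.rep_eq)
    then show False
      using E(2)[OF that] by simp
  qed
  have pos: "(\<integral>\<^sup>+ z. ennreal (f z) \<partial>mixture P) = (\<Sum>i\<in>I. ennreal (w i) * p i)"
    and neg: "(\<integral>\<^sup>+ z. ennreal (- f z) \<partial>mixture P) = (\<Sum>i\<in>I. ennreal (w i) * n i)"
    unfolding p_def n_def using P by (auto intro!: nn_integral_mixture)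
  have neg': "(\<Sum>i\<in>I. ennreal (w i) * n i) = ennreal (\<Sum>i\<in>I. w i * enn2real (n i))"
  proof -
    have "(\<Sum>i\<in>I. ennreal (w i) * n i) = (\<Sum>i\<in>I. ennreal (w i * enn2real (n i)))"
      using n nonneg by (intro sum.cong refl) (simp add: ennreal_mult)
    then show ?thesis
      using nonneg by (simp add: sum_ennreal)
  qed
  \<comment> \<open>The positive parts \<open>p i\<close> may be infinite, so the inequalities are
    summed in the subtraction-free form \<open>c i + n i \<le> p i\<close>; the finite total of the
    negative parts is subtracted only afterwards.\<close>
  have "ereal (\<Sum>i\<in>I. w i * (c i + enn2real (n i))) = (\<Sum>i\<in>I. ereal (w i) * ereal (c i + enn2real (n i)))"
    by simp
  also have "\<dots> \<le> (\<Sum>i\<in>I. ereal (w i) * enn2ereal (p i))"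
  proof (intro sum_mono ereal_mult_left_mono)
    fix i assume i: "i \<in> I"
    obtain b where "n i = ennreal b" "0 \<le> b"
      using n[OF i] by (cases "n i") auto
    then show "ereal (c i + enn2real (n i)) \<le> enn2ereal (p i)"
      using E(2)[OF i]
      by (cases "p i") (auto simp: ext_expectation_def p_def[symmetric] n_def[symmetric]
          enn2ereal_ennreal top_ennreal.rep_eq)
  qed (use nonneg in auto)
  also have "\<dots> = enn2ereal (\<Sum>i\<in>I. ennreal (w i) * p i)"
    using nonneg by (simp add: times_ennreal.rep_eq enn2ereal_ennreal flip: sum_enn2ereal)
  finally have "ereal (\<Sum>i\<in>I. w i * (c i + enn2real (n i))) \<le> enn2ereal (\<Sum>i\<in>I. ennreal (w i) * p i)" .
  then have "ereal (\<Sum>i\<in>I. w i * c i) \<le> ext_expectation (mixture P) f"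
    unfolding ext_expectation_def pos neg neg'
    using nonneg
    by (cases "enn2ereal (\<Sum>i\<in>I. ennreal (w i) * p i)")
      (auto simp: enn2ereal_ennreal sum_nonneg distrib_left sum.distrib)
  also have "has_expectation (mixture P) f"
    unfolding has_expectation_def neg neg' by simp
  then have "ext_expectation (mixture P) f \<le> worst_case M d r \<delta> (mixture Q) f"
    unfolding worst_case_def
    using mixture_in_prob_algebra[of P M] P wasserstein_mixture_le[OF d r \<delta> W]
    by (intro SUP_upper) auto
  finally show "ereal (\<Sum>i\<in>I. w i * c i) \<le> worst_case M d r \<delta> (mixture Q) f" .
qed

end

subsection \<open>Couplings\<close>

lemma couplings_sets:
  assumes "\<pi> \<in> couplings M P Q"
  shows "sets \<pi> = sets (M \<Otimes>\<^sub>M M)"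
  using assms by (simp add: couplings_def space_prob_algebra)

lemma couplings_measurable:
  assumes "\<pi> \<in> couplings M P Q"
  shows "fst \<in> \<pi> \<rightarrow>\<^sub>M M" "snd \<in> \<pi> \<rightarrow>\<^sub>M M"
  by (simp_all add: measurable_cong_sets[OF couplings_sets[OF assms] refl])

text \<open>Supplies what is needed to evaluate, at almost every pair, a Lipschitz bound that holds
  for \<open>Q\<close>-almost every \<open>z\<close> and all \<open>z'\<close> in the space.\<close>

lemma AE_coupling:
  assumes \<pi>: "\<pi> \<in> couplings M P Q" and "AE z in Q. R z"
  shows "AE y in \<pi>. fst y \<in> space M \<and> R (snd y)"
proof -
  have "distr \<pi> M snd = Q"
    using \<pi> by (simp add: couplings_def)
  then have "AE z in distr \<pi> M snd. R z"
    using assms(2) by blast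
  then have "AE y in \<pi>. R (snd y)"
    by (rule AE_distrD[OF couplings_measurable(2)[OF \<pi>]])
  then show ?thesis
    using measurable_space[OF couplings_measurable(1)[OF \<pi>]] by auto
qed

text \<open>The slack between \<delta> and \<eta> replaces an optimal coupling, which need not
  exist.\<close>

lemma exists_coupling_if_wasserstein_le:
  assumes "wasserstein M d r P Q \<le> ennreal \<delta>" "0 < r" "0 \<le> \<delta>" "\<delta> < \<eta>"
  obtains \<pi> where "\<pi> \<in> couplings M P Q"
    "(\<integral>\<^sup>+ y. ennreal_pow (d (fst y) (snd y)) r \<partial>\<pi>) \<le> ennreal (\<eta> powr r)"
proof -
  have "(INF \<pi>\<in>couplings M P Q. \<integral>\<^sup>+ (z', z). ennreal_pow (d z' z) r \<partial>\<pi>) \<le> ennreal (\<delta> powr r)"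
    using assms by (simp add: wasserstein_def ennreal_pow_inverse_le_iff)
  also have "\<dots> < ennreal (\<eta> powr r)"
    using assms by (simp add: ennreal_less_iff powr_less_mono2)
  finally obtain \<pi> where "\<pi> \<in> couplings M P Q"
    "(\<integral>\<^sup>+ (z', z). ennreal_pow (d z' z) r \<partial>\<pi>) < ennreal (\<eta> powr r)"
    unfolding INF_less_iff by blast
  then show thesis
    by (intro that) (auto simp: case_prod_beta' dest: less_imp_le)
qed

section \<open>Bounds on integrals transported along a coupling\<close>

text \<open>Both integrals are pulled back to \<pi>, where Minkowski's inequality is applied to
  \<open>g (snd y)\<close> and \<open>L * d\<close>, with the bounds \<open>A\<close> and
  \<open>L * \<eta>\<close>. The Lipschitz condition is additive because subtraction in
  \<open>ennreal\<close> truncates.\<close>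

lemma nn_integral_pow_coupling_le:
  fixes g :: "'a \<Rightarrow> ennreal"
  assumes \<pi>: "\<pi> \<in> couplings M P Q"
    and d: "(\<lambda>(z', z). d z' z) \<in> borel_measurable (M \<Otimes>\<^sub>M M)"
    and g: "g \<in> borel_measurable M"
    and lip: "AE z in Q. \<forall>z'\<in>space M. g z' \<le> g z + ennreal L * d z' z"
    and pos: "1 \<le> r" "0 < A" "0 < L" "0 < \<eta>"
    and A: "(\<integral>\<^sup>+ z. ennreal_pow (g z) r \<partial>Q) \<le> ennreal (A powr r)"
    and \<eta>: "(\<integral>\<^sup>+ y. ennreal_pow (d (fst y) (snd y)) r \<partial>\<pi>) \<le> ennreal (\<eta> powr r)"
  shows "(\<integral>\<^sup>+ z. ennreal_pow (g z) r \<partial>P) \<le> ennreal ((A + L * \<eta>) powr r)"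
proof -
  note [measurable] = g couplings_measurable[OF \<pi>]
  have [measurable]: "(\<lambda>y. d (fst y) (snd y)) \<in> borel_measurable \<pi>"
    using d by (simp add: measurable_cong_sets[OF couplings_sets[OF \<pi>] refl] case_prod_beta')
  have P: "distr \<pi> M fst = P" and Q: "distr \<pi> M snd = Q"
    using \<pi> by (auto simp: couplings_def)
  have "(\<integral>\<^sup>+ z. ennreal_pow (g z) r \<partial>P) = (\<integral>\<^sup>+ y. ennreal_pow (g (fst y)) r \<partial>\<pi>)"
    by (subst P[symmetric]) (simp add: nn_integral_distr)
  also have "\<dots> \<le> (\<integral>\<^sup>+ y. ennreal_pow (g (snd y) + ennreal L * d (fst y) (snd y)) r \<partial>\<pi>)"
  proof (rule nn_integral_mono_AE)
    show "AE y in \<pi>. ennreal_pow (g (fst y)) r \<le> ennreal_pow (g (snd y) + ennreal L * d (fst y) (snd y)) r"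
      using AE_coupling[OF \<pi> lip] by (rule eventually_mono) (use pos in \<open>auto intro!: ennreal_pow_mono\<close>)
  qed
  also have "\<dots> \<le> ennreal ((A + L * \<eta>) powr r)"
  proof (rule nn_integral_pow_add_le)
    show "(\<integral>\<^sup>+ y. ennreal_pow (g (snd y)) r \<partial>\<pi>) \<le> ennreal (A powr r)"
      using A by (subst (asm) Q[symmetric]) (simp add: nn_integral_distr)
    have "(\<integral>\<^sup>+ y. ennreal_pow (ennreal L * d (fst y) (snd y)) r \<partial>\<pi>)
        = ennreal (L powr r) * (\<integral>\<^sup>+ y. ennreal_pow (d (fst y) (snd y)) r \<partial>\<pi>)"
      using pos by (simp add: ennreal_pow_mult nn_integral_cmult)
    also have "\<dots> \<le> ennreal (L powr r) * ennreal (\<eta> powr r)"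
      by (intro mult_left_mono \<eta>) auto
    finally show "(\<integral>\<^sup>+ y. ennreal_pow (ennreal L * d (fst y) (snd y)) r \<partial>\<pi>) \<le> ennreal ((L * \<eta>) powr r)"
      using pos by (simp add: powr_mult flip: ennreal_mult)
  qed (use pos in auto)
  finally show ?thesis .
qed

text \<open>The difference \<open>h\<close> of \<open>f\<close> at the two coordinates is dominated
  by \<open>L * d\<close> and hence integrable. Adding \<open>f (snd y)\<close> then yields
  integrability under \<open>P\<close> as well as the bound, whatever the sign of
  \<open>f\<close>.\<close>

lemma integral_coupling_le:
  fixes f :: "'a \<Rightarrow> real"
  assumes \<pi>: "\<pi> \<in> couplings M P Q"
    and d: "(\<lambda>(z', z). d z' z) \<in> borel_measurable (M \<Otimes>\<^sub>M M)"
    and f: "f \<in> borel_measurable M" and int: "integrable Q f"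
    and lip: "AE z in Q. \<forall>z'\<in>space M. ennreal \<bar>f z' - f z\<bar> \<le> ennreal L * d z' z"
    and pos: "0 \<le> L" "0 \<le> \<eta>"
    and \<eta>: "(\<integral>\<^sup>+ y. d (fst y) (snd y) \<partial>\<pi>) \<le> ennreal \<eta>"
  shows "integrable P f" "(\<integral>z. f z \<partial>P) \<le> (\<integral>z. f z \<partial>Q) + L * \<eta>"
proof -
  note [measurable] = f couplings_measurable[OF \<pi>]
  have [measurable]: "(\<lambda>y. d (fst y) (snd y)) \<in> borel_measurable \<pi>"
    using d by (simp add: measurable_cong_sets[OF couplings_sets[OF \<pi>] refl] case_prod_beta')
  have P: "distr \<pi> M fst = P" and Q: "distr \<pi> M snd = Q"
    using \<pi> by (auto simp: couplings_def)
  define h where "h y = f (fst y) - f (snd y)" for y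
  have [measurable]: "h \<in> borel_measurable \<pi>"
    unfolding h_def by measurable
  have "(\<integral>\<^sup>+ y. ennreal (norm (h y)) \<partial>\<pi>) \<le> (\<integral>\<^sup>+ y. ennreal L * d (fst y) (snd y) \<partial>\<pi>)"
  proof (rule nn_integral_mono_AE)
    show "AE y in \<pi>. ennreal (norm (h y)) \<le> ennreal L * d (fst y) (snd y)"
      using AE_coupling[OF \<pi> lip] by (rule eventually_mono) (auto simp: h_def)
  qed
  also have "\<dots> \<le> ennreal L * ennreal \<eta>"
    using \<eta> by (simp add: nn_integral_cmult mult_left_mono)
  finally have h_le: "(\<integral>\<^sup>+ y. ennreal (norm (h y)) \<partial>\<pi>) \<le> ennreal (L * \<eta>)"
    using pos by (simp add: ennreal_mult)
  have h: "integrable \<pi> h"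
    using h_le by (intro integrableI_bounded) (auto intro: le_less_trans)
  have s: "integrable \<pi> (\<lambda>y. f (snd y))"
    using int by (subst (asm) Q[symmetric]) (simp add: integrable_distr_eq)
  have fst_eq: "(\<lambda>y. f (fst y)) = (\<lambda>y. h y + f (snd y))"
    by (simp add: h_def)
  have "integrable \<pi> (\<lambda>y. f (fst y))"
    unfolding fst_eq using h s by (rule Bochner_Integration.integrable_add)
  then show "integrable P f"
    by (subst P[symmetric]) (simp add: integrable_distr_eq)
  have "ennreal \<bar>\<integral>y. h y \<partial>\<pi>\<bar> \<le> ennreal (L * \<eta>)"
    using integral_norm_bound_ennreal[OF h] h_le by simp
  then have "(\<integral>y. h y \<partial>\<pi>) \<le> L * \<eta>"
    using pos by (simp add: ennreal_le_iff)
  moreover have "(\<integral>z. f z \<partial>P) = (\<integral>y. f (fst y) \<partial>\<pi>)"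
    by (subst P[symmetric]) (simp add: integral_distr)
  moreover have "(\<integral>z. f z \<partial>Q) = (\<integral>y. f (snd y) \<partial>\<pi>)"
    by (subst Q[symmetric]) (simp add: integral_distr)
  moreover have "(\<integral>y. f (fst y) \<partial>\<pi>) = (\<integral>y. h y \<partial>\<pi>) + (\<integral>y. f (snd y) \<partial>\<pi>)"
    unfolding fst_eq using h s by (rule Bochner_Integration.integral_add)
  ultimately show "(\<integral>z. f z \<partial>P) \<le> (\<integral>z. f z \<partial>Q) + L * \<eta>"
    by simp
qed

section \<open>Balls around Dirac measures\<close>

text \<open>The Dirac measure at \<open>(z, z)\<close> is a coupling of cost 0, since
  \<open>d z z = 0\<close>.\<close>

lemma wasserstein_return_self_le:
  assumes "cost_function M d" "z \<in> space M" "0 < r" "0 \<le> \<delta>"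
  shows "wasserstein M d r (return M z) (return M z) \<le> ennreal \<delta>"
proof -
  have d: "(\<lambda>(z', z). d z' z) \<in> borel_measurable (M \<Otimes>\<^sub>M M)" and "d z z = 0"
    using assms by (auto simp: cost_function_def)
  have c: "(\<lambda>(z', z). ennreal_pow (d z' z) r) \<in> borel_measurable (M \<Otimes>\<^sub>M M)"
    using measurable_ennreal_pow[OF d] by (simp add: case_prod_beta)
  have zz: "(z, z) \<in> space (M \<Otimes>\<^sub>M M)"
    using assms by (simp add: space_pair_measure)
  then have "return (M \<Otimes>\<^sub>M M) (z, z) \<in> couplings M (return M z) (return M z)"
    by (simp add: couplings_def space_prob_algebra prob_space_return distr_return)
  moreover have "(\<integral>\<^sup>+ (z', z). ennreal_pow (d z' z) r \<partial>return (M \<Otimes>\<^sub>M M) (z, z)) = 0"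
    using \<open>d z z = 0\<close> by (subst nn_integral_return[OF zz c]) simp
  ultimately have "(INF \<pi>\<in>couplings M (return M z) (return M z).
      \<integral>\<^sup>+ (z', z). ennreal_pow (d z' z) r \<partial>\<pi>) \<le> ennreal (\<delta> powr r)"
    by (intro INF_lower2) auto
  then show ?thesis
    using assms by (simp add: wasserstein_def ennreal_pow_inverse_le_iff)
qed

text \<open>The centre of the ball is a competitor. The bound also keeps the supremum away from
  -\<infinity>, as \<open>worst_case_mixture_ge\<close> demands.\<close>

lemma worst_case_return_ge:
  assumes "cost_function M d" "z \<in> space M" "0 < r" "0 \<le> \<delta>" and f: "f \<in> borel_measurable M"
  shows "ereal (f z) \<le> worst_case M d r \<delta> (return M z) f"
proof -
  have int: "integrable (return M z) f"
    using assms by (intro integrableI_bounded) (auto simp: nn_integral_return)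
  have "ereal (f z) = ext_expectation (return M z) f"
    using assms integrable_has_expectation(2)[OF int] by (simp add: integral_return)
  also have "\<dots> \<le> worst_case M d r \<delta> (return M z) f"
    unfolding worst_case_def
    using wasserstein_return_self_le[of M d z r \<delta>] assms integrable_has_expectation(1)[OF int]
    by (intro SUP_upper) (auto simp: space_prob_algebra prob_space_return)
  finally show ?thesis .
qed

subsection \<open>Empirical distributions\<close>

lemma empirical_eq_mixture:
  assumes "finite_mixture {1..N} w" "\<And>i. i \<in> {1..N} \<Longrightarrow> x i \<in> space M"
  shows "empirical M N w x = finite_mixture.mixture {1..N} w (\<lambda>i. return M (x i))"
proof -
  interpret finite_mixture "{1..N}" w by fact
  have prob: "return M (x i) \<in> space (prob_algebra M)" if "i \<in> {1..N}" for i
    using assms(2)[OF that] by (simp add: space_prob_algebra prob_space_return)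
  have sets: "sets (mixture (\<lambda>i. return M (x i))) = sets M"
    using mixture_in_prob_algebra[OF prob] by (simp add: space_prob_algebra)
  show ?thesis
  proof (rule measure_eqI)
    fix A assume "A \<in> sets (empirical M N w x)"
    then have A: "A \<in> sets M" "A \<in> sets (mixture (\<lambda>i. return M (x i)))"
      using sets by auto
    have "emeasure (mixture (\<lambda>i. return M (x i))) A
        = (\<Sum>i=1..N. ennreal (w i) * (\<integral>\<^sup>+ z. indicator A z \<partial>return M (x i)))"
      using nn_integral_mixture[where P = "\<lambda>i. return M (x i)", OF prob, where f = "indicator A"] A by simp
    then show "emeasure (empirical M N w x) A = emeasure (mixture (\<lambda>i. return M (x i))) A"
      using A by (simp add: emeasure_empirical)
  qed (use sets in simp)
qed

text \<open>Positive and negative parts are computed separately by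
  \<open>nn_integral_empirical\<close>; \<open>max 0\<close> appears because \<open>ennreal\<close>
  sends negative reals to 0.\<close>

lemma integral_empirical:
  fixes f :: "'a \<Rightarrow> real"
  assumes f: "f \<in> borel_measurable M" and x: "\<And>i. i \<in> {1..N} \<Longrightarrow> x i \<in> space M"
    and \<mu>: "\<And>i. i \<in> {1..N} \<Longrightarrow> 0 \<le> \<mu> i"
  shows "(\<integral>z. f z \<partial>empirical M N \<mu> x) = (\<Sum>i=1..N. \<mu> i * f (x i))"
proof -
  have *: "enn2real (\<integral>\<^sup>+ z. ennreal (g z) \<partial>empirical M N \<mu> x) = (\<Sum>i=1..N. \<mu> i * max 0 (g (x i)))"
    if "g \<in> borel_measurable M" for g :: "'a \<Rightarrow> real"
  proof -
    have "(\<integral>\<^sup>+ z. ennreal (g z) \<partial>empirical M N \<mu> x) = (\<Sum>i=1..N. ennreal (\<mu> i) * ennreal (g (x i)))"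
      using that x by (intro nn_integral_empirical) auto
    also have "\<dots> = (\<Sum>i=1..N. ennreal (\<mu> i * max 0 (g (x i))))"
      using \<mu> by (intro sum.cong refl) (simp add: ennreal_mult max_def ennreal_neg)
    also have "\<dots> = ennreal (\<Sum>i=1..N. \<mu> i * max 0 (g (x i)))"
      using \<mu> by (intro sum_ennreal) auto
    moreover have "0 \<le> (\<Sum>i=1..N. \<mu> i * max 0 (g (x i)))"
      using \<mu> by (intro sum_nonneg mult_nonneg_nonneg) auto
    ultimately show ?thesis
      by simp
  qed
  have "(\<integral>z. f z \<partial>empirical M N \<mu> x)
      = (\<Sum>i=1..N. \<mu> i * max 0 (f (x i))) - (\<Sum>i=1..N. \<mu> i * max 0 (- f (x i)))"
    using f by (subst real_lebesgue_integral_def[OF integrable_empirical[OF f x]]) (simp_all add: *)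
  also have "\<dots> = (\<Sum>i=1..N. \<mu> i * f (x i))"
    unfolding sum_subtractf[symmetric] by (intro sum.cong refl) (simp add: max_def)
  finally show ?thesis .
qed

text \<open>Measurable singletons make the finite dataset measurable, and each Dirac summand gives
  its complement mass 0.\<close>

lemma AE_empirical:
  assumes "\<And>z. z \<in> space M \<Longrightarrow> {z} \<in> sets M" and x: "\<And>i. i \<in> {1..N} \<Longrightarrow> x i \<in> space M"
  shows "AE z in empirical M N \<mu> x. z \<in> x ` {1..N}"
proof -
  have "(\<Union>i\<in>{1..N}. {x i}) \<in> sets M"
    using assms by (intro sets.finite_UN) auto
  then have "space M - x ` {1..N} \<in> sets M"
    by (simp add: UNION_singleton_eq_range sets.compl_sets)
  moreover from this have "emeasure (empirical M N \<mu> x) (space M - x ` {1..N}) = 0"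
    by (subst emeasure_empirical) auto
  ultimately show ?thesis
    by (intro AE_I[where N = "space M - x ` {1..N}"]) auto
qed

theorem theorem3p1:
  fixes M :: "'z measure"
    and d :: "'z \<Rightarrow> 'z \<Rightarrow> ennreal"
    and N :: nat
    and x :: "nat \<Rightarrow> 'z"
    and \<mu> :: "nat \<Rightarrow> real"
    and r \<delta> :: real
    and B :: "'b set"
    and \<beta> :: 'b
    and \<psi> :: "'b \<Rightarrow> 'z \<Rightarrow> real"
    and l :: "'z \<Rightarrow> 'b \<Rightarrow> real"
  assumes "\<And>z. z \<in> space M \<Longrightarrow> {z} \<in> sets M"
    and "cost_function M d"
    and "\<And>i. i \<in> {1..N} \<Longrightarrow> x i \<in> space M"
    and "\<And>i. i \<in> {1..N} \<Longrightarrow> 0 \<le> \<mu> i"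
    and "(\<Sum>i=1..N. \<mu> i) = 1"
    and "1 \<le> r"
    and "\<And>b. b \<in> B \<Longrightarrow> (\<lambda>z. l z b) \<in> borel_measurable M"
    and "\<And>b z. b \<in> B \<Longrightarrow> z \<in> space M \<Longrightarrow> l z b = real_pow (\<psi> b z) r"
    and "\<And>b z. 1 < r \<Longrightarrow> b \<in> B \<Longrightarrow> z \<in> space M \<Longrightarrow> 0 \<le> \<psi> b z"
    and "\<beta> \<in> B"
    and "0 \<le> \<delta>"
  defines "P\<^sub>N \<equiv> empirical M N \<mu> x"
  defines "S \<equiv> worst_case M d r \<delta> P\<^sub>N (\<lambda>z. l z \<beta>)"
  defines "LL \<equiv> (\<lambda>i. worst_case M d r \<delta> (return M (x i)) (\<lambda>z. l z \<beta>))"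
  shows "((\<Sum>i=1..N. ereal (\<mu> i) * LL i) \<le> S \<and>
          ereal (\<integral>z. l z \<beta> \<partial>P\<^sub>N) \<le> (\<Sum>i=1..N. ereal (\<mu> i) * LL i)) \<and>
         (\<forall>L>0. lipschitz_at M d L (x ` {1..N}) (\<psi> \<beta>) \<longrightarrow>
            S \<le> ereal (real_pow (real_pow (\<integral>z. l z \<beta> \<partial>P\<^sub>N) (1 / r) + L * \<delta>) r)) \<and>
         (lipschitz_at M d 0 (x ` {1..N}) (\<psi> \<beta>) \<longrightarrow>
            S = ereal (\<integral>z. l z \<beta> \<partial>P\<^sub>N))"
proof -
  define f where "f = (\<lambda>z. l z \<beta>)"
  define a where "a = (\<integral>z. f z \<partial>P\<^sub>N)"
  have d: "(\<lambda>(z', z). d z' z) \<in> borel_measurable (M \<Otimes>\<^sub>M M)"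
    using assms(2) by (simp add: cost_function_def)
  have f [measurable]: "f \<in> borel_measurable M"
    unfolding f_def using assms by blast
  have f_eq: "f z = real_pow (\<psi> \<beta> z) r" if "z \<in> space M" for z
    unfolding f_def using assms that by blast
  have r: "0 < r"
    using assms by simp
  have mix: "finite_mixture {1..N} \<mu>"
    using assms by (intro finite_mixture.intro) auto
  have P\<^sub>N_mixture: "P\<^sub>N = finite_mixture.mixture {1..N} \<mu> (\<lambda>i. return M (x i))"
    unfolding P\<^sub>N_def using mix assms(3) by (rule empirical_eq_mixture)
  have a_eq: "a = (\<Sum>i=1..N. \<mu> i * f (x i))"
    unfolding a_def P\<^sub>N_def using f assms by (intro integral_empirical) auto
  have LL_ge: "ereal (f (x i)) \<le> LL i" if "i \<in> {1..N}" for i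
    unfolding LL_def f_def[symmetric] using assms that f r by (intro worst_case_return_ge) auto
  have LL_ninf: "worst_case M d r \<delta> (return M (x i)) f \<noteq> - \<infinity>" if "i \<in> {1..N}" for i
    using LL_ge[OF that] unfolding LL_def f_def[symmetric] by auto
  have LL_le_S: "(\<Sum>i=1..N. ereal (\<mu> i) * LL i) \<le> S"
    unfolding S_def LL_def f_def[symmetric] P\<^sub>N_mixture
    using mix d r \<open>0 \<le> \<delta>\<close> f LL_ninf by (rule finite_mixture.worst_case_mixture_ge)
  have a_le_LL: "ereal a \<le> (\<Sum>i=1..N. ereal (\<mu> i) * LL i)"
  proof -
    have "ereal a = (\<Sum>i=1..N. ereal (\<mu> i) * ereal (f (x i)))"
      by (simp add: a_eq)
    also have "\<dots> \<le> (\<Sum>i=1..N. ereal (\<mu> i) * LL i)"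
      using LL_ge assms(4) by (intro sum_mono ereal_mult_left_mono) auto
    finally show ?thesis .
  qed
  \<comment> \<open>The Lipschitz bound is available only at data points, where the empirical
    distribution is concentrated.\<close>
  have AE: "AE z in P\<^sub>N. \<forall>z'\<in>space M. ennreal \<bar>\<psi> \<beta> z' - \<psi> \<beta> z\<bar> \<le> ennreal L * d z' z"
    if "lipschitz_at M d L (x ` {1..N}) (\<psi> \<beta>)" for L
    using AE_empirical[of M N x \<mu>] assms(1,3) that
    unfolding P\<^sub>N_def by (auto simp: lipschitz_at_def elim!: eventually_mono)
  have b: "S \<le> ereal (real_pow (real_pow a (1 / r) + L * \<delta>) r)"
    if L: "0 < L" and lip: "lipschitz_at M d L (x ` {1..N}) (\<psi> \<beta>)" for L
    unfolding S_def f_def[symmetric] worst_case_def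
  proof (rule SUP_least, elim CollectE conjE)
    fix P assume P: "P \<in> space (prob_algebra M)" and W: "wasserstein M d r P P\<^sub>N \<le> ennreal \<delta>"
    have space_P: "space P = space M"
      using P by (auto simp: space_prob_algebra dest: sets_eq_imp_space_eq)
    show "ext_expectation P f \<le> ereal (real_pow (real_pow a (1 / r) + L * \<delta>) r)"
    proof (cases "r = 1")
      case True
      have f_lip: "AE z in P\<^sub>N. \<forall>z'\<in>space M. ennreal \<bar>f z' - f z\<bar> \<le> ennreal L * d z' z"
        using AE[OF lip] AE_space
      proof eventually_elim
        case (elim z)
        then show ?case
          using f_eq True by (simp add: real_pow_def P\<^sub>N_def)
      qed
      have int: "integrable P\<^sub>N f"
        unfolding P\<^sub>N_def using f assms(3) by (intro integrable_empirical) auto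
      have bound: "integrable P f \<and> (\<integral>z. f z \<partial>P) \<le> a + L * \<eta>" if "\<delta> < \<eta>" for \<eta>
      proof -
        obtain \<pi> where \<pi>: "\<pi> \<in> couplings M P P\<^sub>N"
          "(\<integral>\<^sup>+ y. ennreal_pow (d (fst y) (snd y)) r \<partial>\<pi>) \<le> ennreal (\<eta> powr r)"
          using exists_coupling_if_wasserstein_le[OF W r \<open>0 \<le> \<delta>\<close> \<open>\<delta> < \<eta>\<close>] .
        then have "(\<integral>\<^sup>+ y. d (fst y) (snd y) \<partial>\<pi>) \<le> ennreal \<eta>"
          using True that \<open>0 \<le> \<delta>\<close> by (simp add: ennreal_pow_1)
        then show ?thesis
          using integral_coupling_le[OF \<pi>(1) d f int f_lip, of \<eta>] L that \<open>0 \<le> \<delta>\<close>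
          by (simp add: a_def)
      qed
      \<comment> \<open>Lets \<eta> decrease to \<delta>; the choice
        \<open>\<eta> = \<delta> + e / L\<close> turns the slack into exactly
        \<open>e\<close>.\<close>
      have "(\<integral>z. f z \<partial>P) \<le> a + L * \<delta>"
      proof (rule field_le_epsilon)
        fix e :: real assume "0 < e"
        then show "(\<integral>z. f z \<partial>P) \<le> a + L * \<delta> + e"
          using bound[of "\<delta> + e / L"] L by (simp add: distrib_left)
      qed
      moreover have "integrable P f"
        using bound[of "\<delta> + 1"] by simp
      ultimately show ?thesis
        using True by (simp add: integrable_has_expectation(2) real_pow_def)
    next
      case False
      then have "1 < r"
        using assms by simp
      have \<psi>: "0 \<le> \<psi> \<beta> z" if "z \<in> space M" for z
        using assms that \<open>1 < r\<close> by blast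
      have f_powr: "f z = \<psi> \<beta> z powr r" if "z \<in> space M" for z
        using f_eq[OF that] \<open>1 < r\<close> by (simp add: real_pow_def)
      define g where "g z = ennreal (\<psi> \<beta> z)" for z
      \<comment> \<open>Measurability is assumed of the loss, not of \<psi>. For nonnegative \<psi>
        it is recovered by taking the r-th root of the loss.\<close>
      have "g \<in> borel_measurable M \<longleftrightarrow> (\<lambda>z. ennreal (f z powr (1 / r))) \<in> borel_measurable M"
        using \<psi> f_powr r by (intro measurable_cong) (simp add: g_def powr_powr)
      moreover have "(\<lambda>z. ennreal (f z powr (1 / r))) \<in> borel_measurable M"
        by measurable
      ultimately have g: "g \<in> borel_measurable M"
        by blast
      have g_pow: "ennreal_pow (g z) r = ennreal (f z)" if "z \<in> space M" for z
        using \<psi> f_powr that by (simp add: g_def)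
      have g_lip: "AE z in P\<^sub>N. \<forall>z'\<in>space M. g z' \<le> g z + ennreal L * d z' z"
        using AE[OF lip] AE_space
      proof eventually_elim
        case (elim z)
        show ?case
        proof
          fix z' assume z': "z' \<in> space M"
          have "g z' \<le> ennreal (\<psi> \<beta> z + \<bar>\<psi> \<beta> z' - \<psi> \<beta> z\<bar>)"
            unfolding g_def by (intro ennreal_leI) simp
          also have "\<dots> = g z + ennreal \<bar>\<psi> \<beta> z' - \<psi> \<beta> z\<bar>"
            using \<psi>[of z] elim by (simp add: g_def P\<^sub>N_def)
          also have "\<dots> \<le> g z + ennreal L * d z' z"
            using elim z' by (intro add_left_mono) auto
          finally show "g z' \<le> g z + ennreal L * d z' z" .
        qed
      qed
      have a: "(\<integral>\<^sup>+ z. ennreal_pow (g z) r \<partial>P\<^sub>N) = ennreal a" and "0 \<le> a"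
      proof -
        have "integrable P\<^sub>N f"
          unfolding P\<^sub>N_def using f assms(3) by (intro integrable_empirical) auto
        moreover have nonneg: "AE z in P\<^sub>N. 0 \<le> f z"
          using f_powr by (intro AE_I2) (simp add: P\<^sub>N_def)
        ultimately have "(\<integral>\<^sup>+ z. ennreal (f z) \<partial>P\<^sub>N) = ennreal a"
          unfolding a_def by (rule nn_integral_eq_integral)
        moreover have "(\<integral>\<^sup>+ z. ennreal_pow (g z) r \<partial>P\<^sub>N) = (\<integral>\<^sup>+ z. ennreal (f z) \<partial>P\<^sub>N)"
          using g_pow by (intro nn_integral_cong) (simp add: P\<^sub>N_def)
        ultimately show "(\<integral>\<^sup>+ z. ennreal_pow (g z) r \<partial>P\<^sub>N) = ennreal a"
          by simp
        show "0 \<le> a"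
          unfolding a_def using nonneg by (rule integral_nonneg_AE)
      qed
      define b where "b = a powr (1 / r)"
      \<comment> \<open>Here \<open>b\<close> is the norm of order r of \<psi> under
        \<open>P\<^sub>N\<close>. The slack \<open>e\<close> makes room for a near-optimal coupling
        and keeps both bounds in Minkowski's inequality positive even if \<open>b\<close> or
        \<delta> is 0.\<close>
      have bound: "(\<integral>\<^sup>+ z. ennreal (f z) \<partial>P) \<le> ennreal ((b + e + L * (\<delta> + e)) powr r)"
        if e: "0 < e" for e
      proof -
        obtain \<pi> where \<pi>: "\<pi> \<in> couplings M P P\<^sub>N"
          "(\<integral>\<^sup>+ y. ennreal_pow (d (fst y) (snd y)) r \<partial>\<pi>) \<le> ennreal ((\<delta> + e) powr r)"
          using exists_coupling_if_wasserstein_le[OF W r \<open>0 \<le> \<delta>\<close>, of "\<delta> + e"] e by auto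
        have "a = b powr r"
          using \<open>0 \<le> a\<close> r by (simp add: b_def powr_powr)
        also have "\<dots> \<le> (b + e) powr r"
          using e r by (intro powr_mono2) (auto simp: b_def)
        finally have "ennreal a \<le> ennreal ((b + e) powr r)"
          by (rule ennreal_leI)
        moreover have "0 < b + e" "0 < \<delta> + e"
          using e \<open>0 \<le> \<delta>\<close> by (auto simp: b_def intro!: add_nonneg_pos)
        ultimately have "(\<integral>\<^sup>+ z. ennreal_pow (g z) r \<partial>P) \<le> ennreal ((b + e + L * (\<delta> + e)) powr r)"
          using L \<open>1 < r\<close> \<pi> a by (intro nn_integral_pow_coupling_le[OF \<pi>(1) d g g_lip]) auto
        also have "(\<integral>\<^sup>+ z. ennreal_pow (g z) r \<partial>P) = (\<integral>\<^sup>+ z. ennreal (f z) \<partial>P)"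
          using g_pow by (intro nn_integral_cong) (simp add: space_P)
        finally show ?thesis .
      qed
      \<comment> \<open>The limiting base may be 0; \<open>tendsto_powr2\<close> covers this case,
        given a positive exponent and eventually nonnegative bases.\<close>
      have lim: "((\<lambda>e. ennreal ((b + e + L * (\<delta> + e)) powr r)) \<longlongrightarrow> ennreal ((b + L * \<delta>) powr r)) (at_right 0)"
      proof (intro tendsto_ennrealI tendsto_powr2 tendsto_const r)
        have "((\<lambda>e. b + e + L * (\<delta> + e)) \<longlongrightarrow> b + 0 + L * (\<delta> + 0)) (at_right 0)"
          by (intro tendsto_intros)
        then show "((\<lambda>e. b + e + L * (\<delta> + e)) \<longlongrightarrow> b + L * \<delta>) (at_right 0)"
          by simp
        show "\<forall>\<^sub>F e in at_right 0. 0 \<le> b + e + L * (\<delta> + e)"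
          using eventually_at_right_less[of "0 :: real"]
          by eventually_elim (use L \<open>0 \<le> \<delta>\<close> in \<open>simp add: b_def\<close>)
      qed
      have "(\<integral>\<^sup>+ z. ennreal (f z) \<partial>P) \<le> ennreal ((b + L * \<delta>) powr r)"
        using lim by (rule tendsto_lowerbound)
          (use eventually_at_right_less[of "0 :: real"] bound in \<open>auto elim!: eventually_mono\<close>)
      moreover have "(\<integral>\<^sup>+ z. ennreal (- f z) \<partial>P) = (\<integral>\<^sup>+ z. 0 \<partial>P)"
        using f_powr by (intro nn_integral_cong) (simp add: space_P ennreal_neg)
      ultimately have "ext_expectation P f \<le> ereal ((b + L * \<delta>) powr r)"
        unfolding ext_expectation_def
        by (simp add: less_eq_ennreal.rep_eq enn2ereal_ennreal zero_ennreal.rep_eq)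
      then show ?thesis
        using \<open>1 < r\<close> by (simp add: real_pow_def b_def)
    qed
  qed
  have c: "S = ereal a" if lip: "lipschitz_at M d 0 (x ` {1..N}) (\<psi> \<beta>)"
  proof (rule antisym)
    \<comment> \<open>A data point exists because the weights sum to 1, which excludes
      \<open>N = 0\<close>.\<close>
    obtain i where i: "i \<in> {1..N}"
      using finite_mixture.nonempty[OF mix] by blast
    have const: "f z = f (x i)" if z: "z \<in> space M" for z
    proof -
      have "ennreal \<bar>\<psi> \<beta> z - \<psi> \<beta> (x i)\<bar> \<le> ennreal 0 * d z (x i)"
        using lip i z unfolding lipschitz_at_def by blast
      then have "\<psi> \<beta> z = \<psi> \<beta> (x i)"
        by (simp add: ennreal_eq_0_iff)
      then show ?thesis
        by (simp add: f_eq[OF z] f_eq[OF assms(3)[OF i]])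
    qed
    have "f (x j) = f (x i)" if "j \<in> {1..N}" for j
      using const assms(3)[OF that] .
    then have "a = (\<Sum>j=1..N. \<mu> j * f (x i))"
      unfolding a_eq by (intro sum.cong) auto
    also have "\<dots> = f (x i)"
      using assms(5) by (simp flip: sum_distrib_right)
    finally have a: "a = f (x i)" .
    show "S \<le> ereal a"
      unfolding S_def f_def[symmetric] worst_case_def
    proof (rule SUP_least, elim CollectE conjE)
      fix P assume P: "P \<in> space (prob_algebra M)"
      then interpret prob_space P
        by (simp add: space_prob_algebra)
      have sets_P: "sets P = sets M"
        using P by (simp add: space_prob_algebra)
      have "integrable P f \<longleftrightarrow> integrable P (\<lambda>z. a)"
        using const a sets_eq_imp_space_eq[OF sets_P]
        by (intro Bochner_Integration.integrable_cong) auto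
      moreover have "(\<integral>z. f z \<partial>P) = (\<integral>z. a \<partial>P)"
        using const a sets_eq_imp_space_eq[OF sets_P]
        by (intro Bochner_Integration.integral_cong) auto
      ultimately show "ext_expectation P f \<le> ereal a"
        by (simp add: integrable_has_expectation(2) prob_space)
    qed
    show "ereal a \<le> S"
      using a_le_LL LL_le_S by (rule order_trans)
  qed
  show ?thesis
    using LL_le_S a_le_LL b c unfolding a_def f_def by blast
qed

end
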